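(* There exists a graph $H$ with $\chi(H)=3$ such that $\delta_{\mathrm{B}}(H)=\frac{1}{4}$.
   Context: All graphs are finite and simple; $\chi$ is the chromatic number and $\delta(G)$ is the minimum degree of $G$. A graph $G$ is $H$-free if it contains no (not necessarily induced) subgraph isomorphic to $H$; it is maximal $H$-free if it is $H$-free and adding any missing edge on the same vertex set creates a copy of $H$. A blowup of a graph $F$ is obtained by replacing every vertex of $F$ by an independent set (possibly empty) and every edge of $F$ by a complete bipartite graph between the corresponding sets, with no other edges; $G=F[\cdot]$ means that $G$ is some blowup of $F$. The blowup threshold of $H$ is $$\delta_{\mathrm{B}}(H):=\inf\{\alpha\ge 0:\ \exists\,F=F(\alpha,H)\text{ such that every maximal }H\text{-free graph }G\text{ with }\delta(G)\ge\alpha|V(G)|\text{ satisfies }G=F[\cdot]\},$$ where $F$ is a (finite) graph. *)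

theory Defs
  imports Complex_Main "HOL-Library.Disjoint_Sets" "Graph_Theory.Digraph_Isomorphism"
    "Graph_Theory.Digraph_Component" "Graph_Theory.Pair_Digraph"
begin

text \<open>
  A finite simple graph is a \<^locale>\<open>pair_graph\<close>: a finite vertex set together with a symmetric,
  loop-free set of arcs, each edge being represented by its two orientations. Hence the out-degree
  of a vertex is its degree. The null graph is allowed.
\<close>

definition proper_colouring :: "'a pair_pre_digraph \<Rightarrow> nat \<Rightarrow> ('a \<Rightarrow> nat) \<Rightarrow> bool" where
  "proper_colouring G k c \<longleftrightarrow>
     (\<forall>v\<in>pverts G. c v < k) \<and> (\<forall>(u, v)\<in>parcs G. c u \<noteq> c v)"

definition chromatic_number :: "'a pair_pre_digraph \<Rightarrow> nat" where
  "chromatic_number G = (LEAST k. \<exists>c. proper_colouring G k c)"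

text \<open>
  The value for the null graph is a convention that does not influence the blowup threshold, as the
  null graph is a blowup of every graph (with all parts empty).
\<close>

definition min_degree :: "'a pair_pre_digraph \<Rightarrow> nat" where
  "min_degree G = (if pverts G = {} then 0 else Min (out_degree (with_proj G) ` pverts G))"

definition free_of :: "'b pair_pre_digraph \<Rightarrow> 'a pair_pre_digraph \<Rightarrow> bool" where
  "free_of H G \<longleftrightarrow>
     \<not> (\<exists>K :: 'a pair_pre_digraph.
           subgraph (with_proj K) (with_proj G) \<and> digraph_iso (with_proj H) (with_proj K))"

definition add_edge :: "'a \<Rightarrow> 'a \<Rightarrow> 'a pair_pre_digraph \<Rightarrow> 'a pair_pre_digraph" where
  "add_edge u v G = G\<lparr>parcs := parcs G \<union> {(u, v), (v, u)}\<rparr>"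

definition maximal_free_of :: "'b pair_pre_digraph \<Rightarrow> 'a pair_pre_digraph \<Rightarrow> bool" where
  "maximal_free_of H G \<longleftrightarrow>
     free_of H G \<and>
     (\<forall>u\<in>pverts G. \<forall>v\<in>pverts G.
        u \<noteq> v \<and> (u, v) \<notin> parcs G \<longrightarrow> \<not> free_of H (add_edge u v G))"

text \<open>
  The set \<open>B x\<close> replaces the vertex \<open>x\<close> of \<open>F\<close>. Since \<open>F\<close> has no loops and the parts are disjoint,
  the equation for the arcs makes every part independent.
\<close>

definition is_blowup :: "'b pair_pre_digraph \<Rightarrow> 'a pair_pre_digraph \<Rightarrow> bool" where
  "is_blowup F G \<longleftrightarrow>
     (\<exists>B :: 'b \<Rightarrow> 'a set.
        disjoint_family_on B (pverts F) \<and>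
        pverts G = (\<Union>x\<in>pverts F. B x) \<and>
        parcs G = (\<Union>(x, y)\<in>parcs F. B x \<times> B y))"

text \<open>
  Every finite graph is isomorphic to one whose vertices are natural numbers, and all the notions
  involved are invariant under isomorphism, so it suffices to let \<open>F\<close> and \<open>G\<close> range over graphs on
  natural numbers. The set below is bounded below by 0 and contains every \<open>\<alpha> \<ge> 1\<close> (only the null
  graph satisfies the degree condition then), so \<^const>\<open>Inf\<close> is its genuine infimum.
\<close>

definition blowup_threshold :: "'b pair_pre_digraph \<Rightarrow> real" where
  "blowup_threshold H =
     Inf {\<alpha> :: real. 0 \<le> \<alpha> \<and>
       (\<exists>F :: nat pair_pre_digraph. pair_graph F \<and>
          (\<forall>G :: nat pair_pre_digraph.
             pair_graph G \<and> maximal_free_of H G \<and>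
             \<alpha> * real (card (pverts G)) \<le> real (min_degree G) \<longrightarrow> is_blowup F G))}"

end

theory Submission
  imports Defs
begin

text \<open>
  The graph \<open>H\<close> is a chain of five four-cycles, glued at opposite vertices, whose two ends are joined
  by an edge. It is bipartite up to this edge and contains an odd cycle, so its chromatic number is 3.

  \<^emph>\<open>The threshold is at most 1/4.\<close> Let \<open>G\<close> be an \<open>H\<close>-free graph on \<open>n\<close> vertices, \<open>n\<close> large, with all degrees
  at least \<open>(1/4 + e) * n\<close>. Call two vertices related if they have linearly many common neighbours. Among any
  four vertices some two are related (\<open>four_vertices_codeg\<close>), so related vertices form classes of diameter
  at most 5. A path of related vertices is a spine for a chain of four-cycles, and by inserting
  further vertices its length can be made exactly 5 (\<open>lengthen_codeg_path\<close>); hence an edge inside a class would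
  create a copy of \<open>H\<close> (\<open>no_arc_in_codeg_class\<close>). So all classes are independent, and a counting
  argument shows that there are at most two (\<open>at_most_two_classes\<close>). Thus \<open>G\<close> is bipartite and, if it is maximal
  \<open>H\<close>-free, complete bipartite. The finitely many smaller graphs are covered by taking for
  \<open>F\<close> a disjoint union of sufficiently many graphs (\<open>exists_universal_blowup_pattern\<close>).

  \<^emph>\<open>The threshold is at least 1/4.\<close> Take two disjoint complete bipartite graphs with sides of size \<open>n / 4\<close> and
  match one side of the first to both sides of the second. There is no copy of \<open>H\<close>, since vertices of
  different sides have at most one common neighbour. In a maximal \<open>H\<close>-free supergraph the matched
  vertices of the first graph still have pairwise different neighbourhoods, because any further edge of this kind
  creates a copy of \<open>H\<close> (\<open>crossing_arc_creates_chain\<close>). For large \<open>n\<close> it is therefore not a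
  blowup of a given graph.
\<close>

section \<open>Subgraph containment and common neighbours\<close>

text \<open>
  A not necessarily induced copy of \<open>H\<close> in \<open>G\<close>, given as an injective homomorphism.
\<close>

definition embeds :: "'b pair_pre_digraph \<Rightarrow> 'a pair_pre_digraph \<Rightarrow> bool" where
  "embeds H G \<longleftrightarrow> (\<exists>f. inj_on f (pverts H) \<and> f ` pverts H \<subseteq> pverts G \<and>
     (\<forall>(a, b)\<in>parcs H. (f a, f b) \<in> parcs G))"

lemma free_of_iff_not_embeds:
  fixes H :: "'b pair_pre_digraph" and G :: "'a pair_pre_digraph"
  assumes "pair_wf_digraph H" "pair_wf_digraph G"
  shows "free_of H G \<longleftrightarrow> \<not> embeds H G"
proof -
  interpret H: pair_wf_digraph H by fact
  interpret G: pair_wf_digraph G by fact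
  have "(\<exists>K :: 'a pair_pre_digraph. subgraph (with_proj K) (with_proj G) \<and>
          digraph_iso (with_proj H) (with_proj K)) \<longleftrightarrow> embeds H G" (is "?L \<longleftrightarrow> _")
  proof
    assume ?L
    then obtain K :: "'a pair_pre_digraph" and h where
        sub: "subgraph (with_proj K) (with_proj G)"
      and iso: "pre_digraph.digraph_isomorphism (with_proj H) h"
      and K: "with_proj K = app_iso h (with_proj H)"
      unfolding digraph_iso_def by blast
    have inj: "inj_on (iso_verts h) (pverts H)"
      and arc: "\<And>a. a \<in> parcs H \<Longrightarrow> iso_verts h (fst a) = iso_tail h (iso_arcs h a)
                  \<and> iso_verts h (snd a) = iso_head h (iso_arcs h a)"
      using iso unfolding pre_digraph.digraph_isomorphism_def by auto
    have V: "pverts K = iso_verts h ` pverts H"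
      using arg_cong[OF K, of verts] by simp
    have A: "parcs K = iso_arcs h ` parcs H"
      using arg_cong[OF K, of arcs] by simp
    have t: "iso_tail h = fst" using arg_cong[OF K, of tail] by simp
    have hd: "iso_head h = snd" using arg_cong[OF K, of head] by simp
    have "pverts K \<subseteq> pverts G" "parcs K \<subseteq> parcs G" using sub by (auto simp: subgraph_def)
    moreover have "(iso_verts h a, iso_verts h b) \<in> parcs K" if "(a, b) \<in> parcs H" for a b
      using arc[OF that] that A unfolding t hd by auto
    ultimately show "embeds H G" unfolding embeds_def
      using inj V by (intro exI[of _ "iso_verts h"]) auto
  next
    assume "embeds H G"
    then obtain f where inj: "inj_on f (pverts H)" and fV: "f ` pverts H \<subseteq> pverts G"
      and fA: "\<And>a b. (a, b) \<in> parcs H \<Longrightarrow> (f a, f b) \<in> parcs G"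
      unfolding embeds_def by fast
    define K where "K = \<lparr>pverts = f ` pverts H, parcs = map_prod f f ` parcs H\<rparr>"
    define h where "h = \<lparr>iso_verts = f, iso_arcs = map_prod f f, iso_head = snd, iso_tail = fst\<rparr>"
    have "wf_digraph (with_proj K)"
      by unfold_locales (auto simp: K_def dest: H.in_arcsD1 H.in_arcsD2)
    then have "subgraph (with_proj K) (with_proj G)"
      using fV fA G.wf_digraph_axioms by (auto simp: subgraph_def K_def compatible_def)
    moreover have "inj_on (map_prod f f) (parcs H)"
      using map_prod_inj_on[OF inj inj]
      by (rule inj_on_subset) (auto dest: H.in_arcsD1 H.in_arcsD2)
    then have "pre_digraph.digraph_isomorphism (with_proj H) h"
      using inj H.wf_digraph_axioms by (auto simp: pre_digraph.digraph_isomorphism_def h_def)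
    moreover have "with_proj K = app_iso h (with_proj H)"
      by (auto simp: app_iso_def K_def h_def with_proj_def)
    ultimately show ?L unfolding digraph_iso_def by blast
  qed
  then show ?thesis unfolding free_of_def by blast
qed

lemma pair_graph_iff:
  "pair_graph G \<longleftrightarrow> finite (pverts G) \<and> parcs G \<subseteq> pverts G \<times> pverts G \<and>
     sym (parcs G) \<and> irrefl (parcs G)" (is "_ \<longleftrightarrow> ?R")
proof
  assume "pair_graph G"
  then interpret pair_graph G .
  show ?R
    using pair_finite_verts no_loops' arcs_symmetric
    by (auto simp: irrefl_def sym_def dest: in_arcsD1 in_arcsD2)
next
  assume R: ?R
  then have "finite (parcs G)" by (meson finite_SigmaI finite_subset)
  with R show "pair_graph G"
    by unfold_locales (auto simp: irrefl_def symmetric_def)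
qed

text \<open>
  The neighbourhood of \<open>v\<close>, as a set of vertices.
\<close>

definition nbrs :: "'a pair_pre_digraph \<Rightarrow> 'a \<Rightarrow> 'a set" where
  "nbrs G v = {w. (v, w) \<in> parcs G}"

text \<open>
  The codegree: the number of common neighbours. In particular, \<open>codeg G x x\<close> is the degree
  of \<open>x\<close>.
\<close>

definition codeg :: "'a pair_pre_digraph \<Rightarrow> 'a \<Rightarrow> 'a \<Rightarrow> nat" where
  "codeg G x y = card (nbrs G x \<inter> nbrs G y)"

lemma out_degree_eq: "out_degree (with_proj G) v = card (nbrs G v)"
proof -
  have "out_arcs (with_proj G) v = Pair v ` nbrs G v"
    by (auto simp: out_arcs_def nbrs_def)
  then show ?thesis by (simp add: out_degree_def card_image inj_on_def)
qed

lemma le_min_degree_iff: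
  assumes "finite (pverts G)" "pverts G \<noteq> {}"
  shows "d \<le> min_degree G \<longleftrightarrow> (\<forall>v\<in>pverts G. d \<le> card (nbrs G v))"
  using assms by (simp add: min_degree_def out_degree_eq)

context pair_graph
begin

lemma nbrs_subset: "nbrs G v \<subseteq> pverts G"
  by (auto simp: nbrs_def dest: in_arcsD2)

lemma finite_nbrs [simp]: "finite (nbrs G v)"
  using nbrs_subset pair_finite_verts finite_subset by blast

lemma nbrs_sym: "w \<in> nbrs G v \<longleftrightarrow> v \<in> nbrs G w"
  by (auto simp: nbrs_def dest: arcs_symmetric)

lemma codeg_commute: "codeg G x y = codeg G y x"
  by (simp add: codeg_def Int_commute)

text \<open>
  Double counting of the edges between two vertex sets.
\<close>

lemma sum_card_nbrs_swap:
  assumes "finite A" "finite B"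
  shows "(\<Sum>y\<in>B. card (nbrs G y \<inter> A)) = (\<Sum>w\<in>A. card (nbrs G w \<inter> B))"
proof -
  have "(\<Sum>y\<in>B. card (nbrs G y \<inter> A)) = (\<Sum>y\<in>B. \<Sum>w\<in>A. of_bool (w \<in> nbrs G y))"
    using assms by (intro sum.cong refl) (simp add: Int_commute sum.If_cases of_bool_def)
  also have "\<dots> = (\<Sum>w\<in>A. \<Sum>y\<in>B. of_bool (y \<in> nbrs G w))"
    by (subst sum.swap) (simp add: nbrs_sym)
  also have "\<dots> = (\<Sum>w\<in>A. card (nbrs G w \<inter> B))"
    using assms by (intro sum.cong refl) (simp add: Int_commute sum.If_cases of_bool_def)
  finally show ?thesis .
qed

end

section \<open>The chain of four-cycles closed by an edge\<close>

text \<open>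
  The graph \<open>H\<close>. Its spine consists of the vertices \<open>0, 3, 6, 9, 12, 15\<close>; consecutive spine vertices
  \<open>3 * i\<close> and \<open>3 * i + 3\<close> are joined through the two common neighbours \<open>3 * i + 1\<close> and \<open>3 * i + 2\<close>, so
  that they span a four-cycle, and the two ends \<open>0\<close> and \<open>15\<close> of the spine are adjacent. Without the
  edge between \<open>0\<close> and \<open>15\<close> the graph is bipartite, with the whole spine on one side.
\<close>

definition c4_chain :: "nat pair_pre_digraph" where
  "c4_chain = \<lparr>pverts = {..<16},
     parcs = (let A = insert (0, 15)
                (\<Union>i<5. {(3*i, 3*i+1), (3*i, 3*i+2), (3*i+1, 3*i+3), (3*i+2, 3*i+3)})
              in A \<union> A\<inverse>)\<rparr>"

lemma pair_graph_chain: "pair_graph c4_chain"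
  unfolding pair_graph_iff by (auto simp: c4_chain_def sym_def irrefl_def Let_def)

lemma embeds_chain_iff:
  fixes G :: "'a pair_pre_digraph"
  assumes "pair_graph G"
  shows "embeds c4_chain G \<longleftrightarrow> (\<exists>f :: nat \<Rightarrow> 'a. inj_on f {..<16} \<and> f ` {..<16} \<subseteq> pverts G \<and>
    f 15 \<in> nbrs G (f 0) \<and>
    (\<forall>i<5. {f (3*i+1), f (3*i+2)} \<subseteq> nbrs G (f (3*i)) \<inter> nbrs G (f (3*i+3))))"
proof -
  interpret pair_graph G by fact
  have conv: "(\<forall>(a, b)\<in>A \<union> A\<inverse>. (f a, f b) \<in> parcs G) \<longleftrightarrow> (\<forall>(a, b)\<in>A. (f a, f b) \<in> parcs G)"
    for A and f :: "nat \<Rightarrow> 'a"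
    by (auto dest: arcs_symmetric)
  have rev: "(x, f (3*i+3)) \<in> parcs G \<longleftrightarrow> (f (3*i+3), x) \<in> parcs G"
    for f :: "nat \<Rightarrow> 'a" and i x
    by (auto dest: arcs_symmetric)
  have "(\<forall>(a, b)\<in>parcs c4_chain. (f a, f b) \<in> parcs G) \<longleftrightarrow> f 15 \<in> nbrs G (f 0) \<and>
    (\<forall>i<5. {f (3*i+1), f (3*i+2)} \<subseteq> nbrs G (f (3*i)) \<inter> nbrs G (f (3*i+3)))" for f
    unfolding c4_chain_def Let_def pair_pre_digraph.simps conv
    by (simp add: nbrs_def rev) blast
  then show ?thesis by (simp add: embeds_def c4_chain_def)
qed

lemma chain_not_2_colourable: "\<not> proper_colouring c4_chain 2 c"
proof
  assume "proper_colouring c4_chain 2 c"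
  then have c: "\<And>v. v < 16 \<Longrightarrow> c v < 2" "\<And>u v. (u, v) \<in> parcs c4_chain \<Longrightarrow> c u \<noteq> c v"
    by (auto simp: proper_colouring_def c4_chain_def)
  have step: "c (3*i) = c (3*(Suc i))" if "i < 5" for i
  proof -
    have "(3*i, 3*i+1) \<in> parcs c4_chain" "(3*i+1, 3*i+3) \<in> parcs c4_chain"
      using that by (auto simp: c4_chain_def Let_def)
    then have "c (3*i) \<noteq> c (3*i+1)" "c (3*i+1) \<noteq> c (3*i+3)" using c(2) by blast+
    moreover have "c (3*i) < 2" "c (3*i+1) < 2" "c (3*i+3) < 2" using that by (auto intro!: c(1))
    ultimately show ?thesis by (simp add: algebra_simps)
  qed
  have "c 0 = c (3*i)" if "i \<le> 5" for i
    using that by (induction i) (use step in auto)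
  from this[of 5] have "c 0 = c 15" by simp
  moreover have "(0, 15) \<in> parcs c4_chain" by (simp add: c4_chain_def)
  ultimately show False using c(2) by blast
qed

lemma proper_colouring_mono:
  "proper_colouring G k c \<Longrightarrow> k \<le> l \<Longrightarrow> proper_colouring G l c"
  by (force simp: proper_colouring_def)

lemma chromatic_number_chain: "chromatic_number c4_chain = 3"
  unfolding chromatic_number_def
proof (rule Least_equality)
  have "proper_colouring c4_chain 3 (\<lambda>v. if v = 15 then 2 else if 3 dvd v then 0 else 1)"
    by (auto simp: proper_colouring_def c4_chain_def Let_def) presburger+
  then show "\<exists>c. proper_colouring c4_chain 3 c" by blast
next
  fix k assume "\<exists>c. proper_colouring c4_chain k c"
  then show "3 \<le> k" using chain_not_2_colourable proper_colouring_mono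
    by (metis not_less_eq_eq numeral_2_eq_2 numeral_3_eq_3)
qed

section \<open>Building a copy of the closed chain from large codegrees\<close>

text \<open>
  The easy case of the marriage theorem: if every set is at least as large as the family is numerous,
  the representatives can be chosen greedily.
\<close>

lemma distinct_representatives:
  assumes "finite I" "\<And>i. i \<in> I \<Longrightarrow> card I \<le> card (S i)"
  obtains r where "inj_on r I" "\<And>i. i \<in> I \<Longrightarrow> r i \<in> S i"
proof -
  have "\<exists>r. inj_on r I \<and> (\<forall>i\<in>I. r i \<in> S i)"
    using assms
  proof (induction I rule: finite_induct)
    case (insert x F)
    have "card F \<le> card (S i)" if "i \<in> F" for i
      using insert.prems[of i] insert.hyps that by simp
    then obtain r where r: "inj_on r F" "\<forall>i\<in>F. r i \<in> S i" using insert.IH by blast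
    have "card (r ` F) < card (S x)"
      using insert.prems[of x] insert.hyps card_image_le[OF insert.hyps(1), of r] by simp
    then have "\<not> S x \<subseteq> r ` F"
      using insert.hyps by (meson card_mono finite_imageI leD)
    then obtain y where "y \<in> S x" "y \<notin> r ` F" by blast
    then have "inj_on (r(x := y)) (insert x F) \<and> (\<forall>i\<in>insert x F. (r(x := y)) i \<in> S i)"
      using r insert.hyps by (auto simp: inj_on_def)
    then show ?case by blast
  qed simp
  then show ?thesis using that by blast
qed

context pair_graph
begin

text \<open>
  Four neighbourhoods, each of more than a quarter of all vertices, cannot be almost disjoint: by the
  second Bonferroni inequality some two of them have a large intersection.
\<close>

lemma four_vertices_codeg:
  fixes c d :: real
  assumes deg: "\<And>v. v \<in> pverts G \<Longrightarrow> d \<le> card (nbrs G v)"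
    and large: "card (pverts G) + 6 * c < 4 * d"
    and V: "{x, y, z, w} \<subseteq> pverts G"
  shows "c \<le> codeg G x y \<or> c \<le> codeg G x z \<or> c \<le> codeg G x w \<or>
         c \<le> codeg G y z \<or> c \<le> codeg G y w \<or> c \<le> codeg G z w"
proof (rule ccontr)
  assume neg: "\<not> ?thesis"
  let ?N = "nbrs G"
  have union: "real (card A) + card B \<le> card (A \<union> B) + card (A \<inter> B)"
    if "finite A" "finite B" for A B :: "'a set"
    using card_Un_Int[OF that] by linarith
  have dist: "real (card ((A \<union> B) \<inter> C)) \<le> card (A \<inter> C) + card (B \<inter> C)" for A B C :: "'a set"
    using card_Un_le[of "A \<inter> C" "B \<inter> C"] by (simp add: Int_Un_distrib2)
  have "real (card (?N x)) + card (?N y) \<le> card (?N x \<union> ?N y) + codeg G x y"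
    using union[of "?N x" "?N y"] by (simp add: codeg_def)
  moreover have "real (card (?N x \<union> ?N y)) + card (?N z)
      \<le> card (?N x \<union> ?N y \<union> ?N z) + codeg G x z + codeg G y z"
    using union[of "?N x \<union> ?N y" "?N z"] dist[of "?N x" "?N y" "?N z"] by (simp add: codeg_def)
  moreover have "real (card (?N x \<union> ?N y \<union> ?N z)) + card (?N w)
      \<le> card (?N x \<union> ?N y \<union> ?N z \<union> ?N w) + codeg G x w + codeg G y w + codeg G z w"
    using union[of "?N x \<union> ?N y \<union> ?N z" "?N w"] dist[of "?N x \<union> ?N y" "?N z" "?N w"]
      dist[of "?N x" "?N y" "?N w"] by (simp add: codeg_def)
  moreover have "real (card (?N x \<union> ?N y \<union> ?N z \<union> ?N w)) \<le> card (pverts G)"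
    using nbrs_subset by (intro of_nat_mono card_mono pair_finite_verts) blast
  ultimately show False
    using neg large deg[of x] deg[of y] deg[of z] deg[of w] V by (simp add: not_le)
qed

text \<open>
  Between two vertices \<open>x\<close> and \<open>y\<close> one can insert a third vertex, outside a given small set, at the cost
  of a factor of 8 in the codegrees. The set \<open>W\<close> of common neighbours of \<open>x\<close> and \<open>y\<close> sends at least
  \<open>card W * n / 4\<close> edges to all \<open>n\<close> vertices, so at least \<open>n / 8\<close> vertices \<open>z\<close> have
  at least \<open>card W / 8\<close> neighbours in \<open>W\<close>. Each of these neighbours is common to \<open>z\<close> and \<open>x\<close> and also common to
  \<open>z\<close> and \<open>y\<close>.
\<close>

lemma interpolate_codeg:
  assumes deg: "\<And>v. v \<in> pverts G \<Longrightarrow> real (card (pverts G)) / 4 \<le> card (nbrs G v)"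
    and pos: "codeg G x y > 0"
    and X: "finite X" "8 * card X < card (pverts G)"
  obtains z where "z \<in> pverts G - X" "codeg G x y \<le> 8 * codeg G x z" "codeg G x y \<le> 8 * codeg G z y"
proof -
  let ?V = "pverts G"
  define W where "W = nbrs G x \<inter> nbrs G y"
  define Z where "Z = {z \<in> ?V. card W \<le> 8 * card (nbrs G z \<inter> W)}"
  have fW: "finite W" and WV: "W \<subseteq> ?V" using nbrs_subset by (auto simp: W_def)
  have W0: "card W > 0" using pos by (simp add: W_def codeg_def)
  have "\<not> Z \<subseteq> X"
  proof
    assume "Z \<subseteq> X"
    then have "card Z \<le> card X" using X card_mono by blast
    then have cZ: "8 * real (card Z) < card ?V" using X by linarith
    have "card W * (real (card ?V) / 4) \<le> (\<Sum>w\<in>W. real (card (nbrs G w \<inter> ?V)))"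
      using deg WV nbrs_subset by (intro sum_bounded_below) (auto simp: Int_absorb2)
    also have "\<dots> = (\<Sum>z\<in>?V. real (card (nbrs G z \<inter> W)))"
      using sum_card_nbrs_swap[OF fW pair_finite_verts] by (metis of_nat_sum)
    also have "\<dots> \<le> (\<Sum>z\<in>?V. real (card W) / 8 + of_bool (z \<in> Z) * card W)"
    proof (rule sum_mono)
      fix z assume "z \<in> ?V"
      have "card (nbrs G z \<inter> W) \<le> card W" by (intro card_mono fW) auto
      then show "real (card (nbrs G z \<inter> W)) \<le> real (card W) / 8 + of_bool (z \<in> Z) * card W"
        using \<open>z \<in> ?V\<close> by (auto simp: Z_def)
    qed
    also have "\<dots> = card ?V * (real (card W) / 8) + card Z * card W"
    proof -
      have "?V \<inter> {z. z \<in> Z} = Z" by (auto simp: Z_def)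
      then have "(\<Sum>z\<in>?V. real (of_bool (z \<in> Z))) = card Z"
        using pair_finite_verts by (simp add: sum_of_bool_eq)
      then show ?thesis by (simp add: sum.distrib flip: sum_distrib_right)
    qed
    finally have "card W * (8 * real (card Z)) \<ge> card W * real (card ?V)"
      by (simp add: field_simps)
    then show False using cZ W0 by simp
  qed
  then obtain z where z: "z \<in> ?V" "z \<notin> X" "card W \<le> 8 * card (nbrs G z \<inter> W)"
    by (auto simp: Z_def)
  have "card (nbrs G z \<inter> W) \<le> codeg G x z" "card (nbrs G z \<inter> W) \<le> codeg G z y"
    unfolding codeg_def W_def by (intro card_mono; auto)+
  then show ?thesis using z by (intro that[of z]) (auto simp: codeg_def W_def)
qed

text \<open>
  Repeated insertion makes a path of vertices with large consecutive codegrees longer by exactly \<open>j\<close>.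
\<close>

lemma lengthen_codeg_path:
  fixes k :: real
  assumes deg: "\<And>v. v \<in> pverts G \<Longrightarrow> real (card (pverts G)) / 4 \<le> card (nbrs G v)"
    and k: "k > 0"
    and path: "successively (\<lambda>u v. k \<le> codeg G u v) xs" "distinct xs" "set xs \<subseteq> pverts G"
    and len: "2 \<le> length xs" "8 * (length xs + j) \<le> card (pverts G)"
  shows "\<exists>ys. successively (\<lambda>u v. k / 8 ^ j \<le> codeg G u v) ys \<and> distinct ys \<and>
    set ys \<subseteq> pverts G \<and> length ys = length xs + j \<and> hd ys = hd xs \<and> last ys = last xs"
  using len(2)
proof (induction j)
  case 0
  then show ?case using path by (intro exI[of _ xs]) simp
next
  case (Suc j)
  then obtain ys where ys: "successively (\<lambda>u v. k / 8 ^ j \<le> codeg G u v) ys" "distinct ys"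
      "set ys \<subseteq> pverts G" "length ys = length xs + j" "hd ys = hd xs" "last ys = last xs"
    by auto
  obtain x y zs where yeq: "ys = x # y # zs"
    using ys(4) len(1) by (cases ys rule: remdups_adj.cases) auto
  have kj: "k / 8 ^ j > 0" using k by simp
  have xy: "k / 8 ^ j \<le> codeg G x y" and rest: "successively (\<lambda>u v. k / 8 ^ j \<le> codeg G u v) (y # zs)"
    using ys(1) yeq by auto
  have "codeg G x y > 0" using xy kj by linarith
  moreover have "8 * card (set ys) < card (pverts G)"
    using ys(2,4) Suc.prems by (simp add: distinct_card)
  ultimately obtain z where z: "z \<in> pverts G - set ys"
      "codeg G x y \<le> 8 * codeg G x z" "codeg G x y \<le> 8 * codeg G z y"
    using interpolate_codeg[OF deg] by blast
  have le: "k / 8 ^ Suc j \<le> k / 8 ^ j" using k by (simp add: field_simps)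
  have scale: "k / 8 ^ Suc j \<le> c" if "codeg G x y \<le> 8 * c" for c :: nat
  proof -
    have "k / 8 ^ j \<le> 8 * real c" using xy that by linarith
    then show ?thesis by (simp add: field_simps)
  qed
  have "k / 8 ^ Suc j \<le> codeg G x z" "k / 8 ^ Suc j \<le> codeg G z y"
    using scale z(2,3) by blast+
  moreover have "successively (\<lambda>u v. k / 8 ^ Suc j \<le> codeg G u v) (y # zs)"
    using rest by (rule successively_mono) (use le in auto)
  ultimately have "successively (\<lambda>u v. k / 8 ^ Suc j \<le> codeg G u v) (x # z # y # zs)" by simp
  then show ?case using ys z yeq
    by (intro exI[of _ "x # z # y # zs"]) auto
qed

text \<open>
  A path of six vertices with large consecutive codegrees and adjacent ends serves as the spine of a copy
  of \<open>H\<close>. The constant is 22 = 16 + 6: after discarding the six spine vertices, 16 common neighbours remain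
  for each of the ten vertices off the spine.
\<close>

lemma embeds_chain_of_codeg_path:
  assumes path: "successively (\<lambda>u v. 22 \<le> codeg G u v) xs" "distinct xs" "set xs \<subseteq> pverts G"
    and len: "length xs = 6" and edge: "(hd xs, last xs) \<in> parcs G"
  shows "embeds c4_chain G"
proof -
  define I where "I = {k :: nat. k < 16 \<and> \<not> 3 dvd k}"
  define S where "S k = nbrs G (xs ! (k div 3)) \<inter> nbrs G (xs ! (k div 3 + 1)) - set xs" for k
  have cI: "finite I" "card I \<le> 16"
  proof -
    have "I \<subseteq> {..<16}" by (auto simp: I_def)
    then show "finite I" "card I \<le> 16"
      using finite_subset card_mono[of "{..<16::nat}" I] by auto
  qed
  have "card I \<le> card (S k)" if "k \<in> I" for k
  proof -
    have "k < 16" "\<not> 3 dvd k" using that by (auto simp: I_def)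
    then have "k div 3 + 1 < length xs" unfolding len by presburger
    then have "22 \<le> codeg G (xs ! (k div 3)) (xs ! (k div 3 + 1))"
      using path(1) by (auto simp: successively_conv_nth)
    moreover have "card (set xs) = 6" using path(2) len by (simp add: distinct_card)
    ultimately have "16 \<le> card (S k)"
      using diff_card_le_card_Diff[of "set xs"
          "nbrs G (xs ! (k div 3)) \<inter> nbrs G (xs ! (k div 3 + 1))"]
      unfolding S_def codeg_def by simp
    then show ?thesis using cI by linarith
  qed
  then obtain r where r: "inj_on r I" "\<And>k. k \<in> I \<Longrightarrow> r k \<in> S k"
    using distinct_representatives[OF cI(1), of S] by blast
  define f where "f k = (if 3 dvd k then xs ! (k div 3) else r k)" for k :: nat
  have f3: "f (3 * i) = xs ! i" for i by (simp add: f_def)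
  have f3': "f (3 * i + 3) = xs ! Suc i" for i using f3[of "Suc i"] by (simp add: algebra_simps)
  have mem: "f k \<in> set xs" if "3 dvd k" "k < 16" for k
    using that len by (auto simp: f_def)
  have mem': "f k \<in> S k" "k \<in> I" if "\<not> 3 dvd k" "k < 16" for k
    using that r by (auto simp: f_def I_def)
  have "inj_on f {..<16}"
  proof (rule inj_onI)
    fix a b :: nat assume ab: "a \<in> {..<16}" "b \<in> {..<16}" "f a = f b"
    have "3 dvd a \<longleftrightarrow> 3 dvd b"
      using mem[of a] mem[of b] mem'[of a] mem'[of b] ab by (auto simp: S_def)
    moreover have "a = b" if "3 dvd a" "3 dvd b"
    proof -
      have "xs ! (a div 3) = xs ! (b div 3)" using ab that by (simp add: f_def)
      moreover have "a div 3 < length xs" "b div 3 < length xs" using ab len by auto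
      ultimately have "a div 3 = b div 3" using path(2) nth_eq_iff_index_eq by blast
      then show "a = b" using that by auto
    qed
    moreover have "a = b" if "\<not> 3 dvd a" "\<not> 3 dvd b"
      using ab that r(1) mem'(2) by (auto simp: f_def dest: inj_onD)
    ultimately show "a = b" by blast
  qed
  moreover have "f ` {..<16} \<subseteq> pverts G"
  proof (rule image_subsetI)
    fix k :: nat assume "k \<in> {..<16}"
    then show "f k \<in> pverts G"
      using mem[of k] mem'(1)[of k] path(3) nbrs_subset[of "xs ! (k div 3)"] by (auto simp: S_def)
  qed
  moreover have "f 15 \<in> nbrs G (f 0)"
  proof -
    have "xs \<noteq> []" using len by auto
    then show ?thesis
      using edge len f3[of 0] f3[of 5] by (simp add: nbrs_def hd_conv_nth last_conv_nth)
  qed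
  moreover have "{f (3*i+1), f (3*i+2)} \<subseteq> nbrs G (f (3*i)) \<inter> nbrs G (f (3*i+3))" if "i < 5" for i
  proof -
    have "\<not> 3 dvd 3*i+1" "\<not> 3 dvd 3*i+2" by presburger+
    then have "f (3*i+1) \<in> S (3*i+1)" "f (3*i+2) \<in> S (3*i+2)" using mem' that by auto
    moreover have "(3*i+1) div 3 = i" "(3*i+2) div 3 = i" by simp_all
    ultimately show ?thesis unfolding f3 f3' S_def by (metis DiffD1 Suc_eq_plus1 empty_subsetI insert_subset)
  qed
  ultimately show ?thesis
    unfolding embeds_chain_iff[OF pair_graph_axioms] by blast
qed

section \<open>Codegree classes\<close>

text \<open>
  The relation of having at least \<open>c\<close> common neighbours. Its reflexive-transitive closure partitions
  the vertices into \<^emph>\<open>codegree classes\<close>.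
\<close>

definition codeg_rel :: "real \<Rightarrow> ('a \<times> 'a) set" where
  "codeg_rel c = {(u, v) \<in> pverts G \<times> pverts G. c \<le> codeg G u v}"

lemma equiv_codeg_rel_rtrancl:
  "equiv (pverts G) ((codeg_rel c)\<^sup>* \<inter> pverts G \<times> pverts G)"
proof -
  have "sym (codeg_rel c)" by (auto simp: codeg_rel_def sym_def codeg_commute)
  then have "sym ((codeg_rel c)\<^sup>*)" by (rule sym_rtrancl)
  then show ?thesis
    by (auto simp: equiv_def refl_on_def sym_def intro!: transI intro: rtrancl_trans)
qed

lemma walk_of_relpow:
  "(u, v) \<in> R ^^ k \<Longrightarrow>
    \<exists>xs. length xs = Suc k \<and> hd xs = u \<and> last xs = v \<and> successively (\<lambda>x y. (x, y) \<in> R) xs"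
proof (induction k arbitrary: v)
  case 0
  then show ?case by (intro exI[of _ "[u]"]) simp
next
  case (Suc k)
  then obtain w where w: "(u, w) \<in> R ^^ k" "(w, v) \<in> R" by auto
  with Suc.IH obtain xs where "length xs = Suc k" "hd xs = u" "last xs = w"
      "successively (\<lambda>x y. (x, y) \<in> R) xs"
    by blast
  with w(2) have "(w, v) \<in> R" "length xs = Suc k" "hd xs = u" "last xs = w"
      "successively (\<lambda>x y. (x, y) \<in> R) xs" by auto
  then show ?case
    by (intro exI[of _ "xs @ [v]"]) (auto simp: successively_append_iff hd_append)
qed

text \<open>
  Inside a codegree class, paths with large consecutive codegrees need at most six vertices: among the
  vertices at positions 0, 2, 4 and 6 of a walk of seven vertices some two are related, which allows for a
  shortcut. As the relation is reflexive, this says that its sixth power is contained in its fifth.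
\<close>

lemma exists_short_codeg_path:
  fixes c d :: real
  assumes deg: "\<And>v. v \<in> pverts G \<Longrightarrow> d \<le> card (nbrs G v)"
    and large: "card (pverts G) + 6 * c < 4 * d" and cd: "c \<le> d"
    and uv: "(u, v) \<in> (codeg_rel c)\<^sup>*" "u \<in> pverts G"
  obtains xs where "xs \<noteq> []" "length xs \<le> 6" "distinct xs" "set xs \<subseteq> pverts G"
    "hd xs = u" "last xs = v" "successively (\<lambda>x y. c \<le> codeg G x y) xs"
proof -
  let ?R = "codeg_rel c" and ?V = "pverts G"
  have refl: "(x, x) \<in> ?R" if "x \<in> ?V" for x
    using deg[OF that] cd that by (simp add: codeg_rel_def codeg_def)
  have in_V: "x \<in> ?V" "y \<in> ?V" if "(x, y) \<in> ?R" for x y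
    using that by (auto simp: codeg_rel_def)
  have pow5: "(x, y) \<in> ?R ^^ 5 \<longleftrightarrow> (\<exists>x1 x2 x3 x4. (x, x1) \<in> ?R \<and> (x1, x2) \<in> ?R \<and>
      (x2, x3) \<in> ?R \<and> (x3, x4) \<in> ?R \<and> (x4, y) \<in> ?R)" for x y
    by (simp add: eval_nat_numeral relcomp_unfold) blast
  have extend: "(x, z) \<in> ?R ^^ 5" if xy: "(x, y) \<in> ?R ^^ 5" and yz: "(y, z) \<in> ?R" for x y z
  proof -
    obtain x1 x2 x3 x4 where w: "(x, x1) \<in> ?R" "(x1, x2) \<in> ?R" "(x2, x3) \<in> ?R" "(x3, x4) \<in> ?R"
        "(x4, y) \<in> ?R"
      using xy unfolding pow5 by blast
    have V: "{x, x2, x4, z} \<subseteq> ?V" using w yz in_V by blast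
    have "(x, x2) \<in> ?R \<or> (x, x4) \<in> ?R \<or> (x, z) \<in> ?R \<or> (x2, x4) \<in> ?R \<or> (x2, z) \<in> ?R \<or> (x4, z) \<in> ?R"
      using four_vertices_codeg[OF deg large V] V by (simp add: codeg_rel_def)
    then show ?thesis
      using w yz refl in_V unfolding pow5 by meson
  qed
  have "(u, v) \<in> ?R ^^ 5"
    using uv(1)
  proof (induction rule: rtrancl_induct)
    case base
    show ?case using refl[OF uv(2)] unfolding pow5 by blast
  next
    case (step y z)
    show ?case by (rule extend[OF step.IH step.hyps(2)])
  qed
  define P where "P ys \<longleftrightarrow> ys \<noteq> [] \<and> hd ys = u \<and> last ys = v \<and>
    successively (\<lambda>x y. (x, y) \<in> ?R) ys" for ys
  obtain ws where "length ws = Suc 5" "hd ws = u" "last ws = v"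
      "successively (\<lambda>x y. (x, y) \<in> ?R) ws"
    using walk_of_relpow[OF \<open>(u, v) \<in> ?R ^^ 5\<close>] by blast
  then have ws: "P ws" "length ws = 6" by (auto simp: P_def)
  \<comment> \<open>A walk of minimal length repeats no vertex.\<close>
  define xs where "xs = arg_min length P"
  have xs: "P xs" and min: "\<And>ys. P ys \<Longrightarrow> length xs \<le> length ys"
    using ws(1) arg_min_natI[of P ws length] arg_min_nat_le[of P _ length] by (auto simp: xs_def)
  have "distinct xs"
  proof (rule ccontr)
    assume "\<not> distinct xs"
    then obtain as y bs cs where eq: "xs = as @ [y] @ bs @ [y] @ cs"
      using not_distinct_decomp by blast
    have "successively (\<lambda>x y. (x, y) \<in> ?R) ((as @ [y] @ bs) @ (y # cs))"
      using xs by (simp add: P_def eq)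
    then have "successively (\<lambda>x y. (x, y) \<in> ?R) (y # cs)"
      unfolding successively_append_iff by blast
    moreover have "successively (\<lambda>x y. (x, y) \<in> ?R) (as @ (y # bs @ [y] @ cs))"
      using xs by (simp add: P_def eq)
    then have "successively (\<lambda>x y. (x, y) \<in> ?R) as \<and> (as = [] \<or> (last as, y) \<in> ?R)"
      unfolding successively_append_iff by auto
    ultimately have "successively (\<lambda>x y. (x, y) \<in> ?R) (as @ y # cs)"
      unfolding successively_append_iff by auto
    moreover have "hd (as @ y # cs) = hd xs" "last (as @ y # cs) = last xs"
      by (simp_all add: eq hd_append)
    ultimately have "P (as @ [y] @ cs)" using xs by (simp add: P_def)
    then show False using min[of "as @ [y] @ cs"] by (simp add: eq)
  qed
  moreover have "set xs \<subseteq> ?V"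
  proof (cases "length xs = 1")
    case True
    then show ?thesis using xs uv(2) by (cases xs) (auto simp: P_def)
  next
    case False
    have "xs ! i \<in> ?V" if i: "i < length xs" for i
    proof (cases "Suc i < length xs")
      case True
      then show ?thesis using xs in_V by (auto simp: P_def successively_conv_nth)
    next
      case F: False
      then obtain j where "i = Suc j" using False i by (cases i) auto
      then show ?thesis using xs in_V i by (auto simp: P_def successively_conv_nth)
    qed
    then show ?thesis by (auto simp: in_set_conv_nth)
  qed
  moreover have "length xs \<le> 6" using min[OF ws(1)] ws(2) by simp
  moreover have "successively (\<lambda>x y. c \<le> codeg G x y) xs"
    using xs unfolding P_def by (auto simp: codeg_rel_def elim!: successively_mono)
  ultimately show ?thesis using xs that by (auto simp: P_def)
qed

text \<open>
  In a graph without a copy of \<open>H\<close> codegree classes are independent: a path with two to six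
  vertices that joins the ends of an edge inside a class is lengthened to exactly six vertices, which
  takes at most four insertions, and this yields a copy of \<open>H\<close>.
\<close>

lemma no_arc_in_codeg_class:
  fixes c d :: real
  assumes deg: "\<And>v. v \<in> pverts G \<Longrightarrow> d \<le> card (nbrs G v)"
    and large: "card (pverts G) + 6 * c < 4 * d" and cd: "c \<le> d"
    and c: "22 * 8 ^ 4 \<le> c"
    and free: "\<not> embeds c4_chain G"
    and uv: "(u, v) \<in> (codeg_rel c)\<^sup>*"
  shows "(u, v) \<notin> parcs G"
proof
  assume arc: "(u, v) \<in> parcs G"
  let ?n = "card (pverts G)"
  have uV: "u \<in> pverts G" and neq: "u \<noteq> v" using arc in_arcsD1 no_loops' by auto
  have deg4: "real ?n / 4 \<le> card (nbrs G w)" if "w \<in> pverts G" for w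
    using deg[OF that] large c by simp
  have "c \<le> card (nbrs G u)" using deg[OF uV] cd by simp
  also have "card (nbrs G u) \<le> ?n" using nbrs_subset by (intro card_mono pair_finite_verts)
  finally have n: "48 \<le> ?n" using c by simp
  obtain xs where xs: "xs \<noteq> []" "length xs \<le> 6" "distinct xs" "set xs \<subseteq> pverts G"
    "hd xs = u" "last xs = v" "successively (\<lambda>x y. c \<le> codeg G x y) xs"
    using exists_short_codeg_path[OF deg large cd uv uV] by blast
  have len: "2 \<le> length xs"
    using xs neq by (cases xs rule: remdups_adj.cases) auto
  define j where "j = 6 - length xs"
  have j: "length xs + j = 6" "j \<le> 4" using xs(2) len by (auto simp: j_def)
  obtain ys where ys: "successively (\<lambda>u v. c / 8 ^ j \<le> codeg G u v) ys" "distinct ys"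
      "set ys \<subseteq> pverts G" "length ys = length xs + j" "hd ys = hd xs" "last ys = last xs"
    using lengthen_codeg_path[OF deg4 _ xs(7,3,4) len, of j] c n j by auto
  have "(8::real) ^ j \<le> 8 ^ 4" using j by (intro power_increasing) auto
  then have "22 * 8 ^ j \<le> c" using c by linarith
  then have "22 \<le> c / 8 ^ j" by (simp add: field_simps)
  then have "successively (\<lambda>u v. 22 \<le> codeg G u v) ys"
    using ys(1) by (auto elim!: successively_mono)
  then have "embeds c4_chain G"
    using embeds_chain_of_codeg_path ys xs j arc by metis
  then show False using free by simp
qed

text \<open>
  Let the vertices be partitioned into independent classes such that vertices of different classes have few
  common neighbours, while all degrees exceed a quarter of the number \<open>n\<close> of vertices. Then there are at
  most two classes.

  Let \<open>D z\<close> consist of the vertices with almost all of their neighbours in the class of \<open>z\<close>, where almost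
  all means all but at most \<open>s * n\<close>.
  Counting paths of length two that leave the class of \<open>z\<close> shows that almost all neighbours of \<open>z\<close> lie in
  \<open>D z\<close>. Hence a vertex \<open>w\<close> of the set \<open>W y z\<close>, the part of \<open>D z\<close> inside the class of \<open>y\<close>, has almost all of
  its neighbours both in \<open>D w = D y\<close> and in the class of \<open>z\<close>, that is, in \<open>W z y\<close>. So \<open>W y z\<close> and \<open>W z y\<close> are
  either both empty or both larger than \<open>n / 4\<close>. Every class occurs in a nonempty pair, and if there
  were more than two classes, there would be two different such pairs: four disjoint sets
  of more than \<open>n / 4\<close> vertices.
\<close>

lemma at_most_two_classes:
  fixes s d :: real
  assumes E: "equiv (pverts G) E" and indep: "\<And>u v. (u, v) \<in> parcs G \<Longrightarrow> (u, v) \<notin> E"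
    and s: "s > 0" and large: "card (pverts G) / 4 + 2 * s * card (pverts G) < d"
    and deg: "\<And>v. v \<in> pverts G \<Longrightarrow> d \<le> card (nbrs G v)"
    and codeg: "\<And>u v. u \<in> pverts G \<Longrightarrow> v \<in> pverts G \<Longrightarrow> (u, v) \<notin> E \<Longrightarrow> codeg G u v \<le> s\<^sup>2 * card (pverts G)"
    and x: "x \<in> pverts G"
  obtains w where "w \<in> pverts G" "\<And>z. z \<in> pverts G \<Longrightarrow> (z, x) \<in> E \<or> (z, w) \<in> E"
proof -
  let ?V = "pverts G" and ?N = "nbrs G"
  let ?n = "real (card ?V)"
  have n: "?n > 0" using x pair_finite_verts by (auto simp: card_gt_0_iff)
  have fin: "finite A" if "A \<subseteq> ?V" for A using that pair_finite_verts finite_subset by blast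
  have symE: "\<And>u v. (u, v) \<in> E \<Longrightarrow> (v, u) \<in> E"
    and reflE: "\<And>v. v \<in> ?V \<Longrightarrow> (v, v) \<in> E"
    using E by (auto elim!: equivE simp: refl_on_def dest: symD)
  define D where "D z = {w \<in> ?V. card (?N w - E `` {z}) \<le> s * ?n}" for z
  define W where "W y z = E `` {y} \<inter> D z" for y z
  have DV: "D z \<subseteq> ?V" and WV: "W y z \<subseteq> ?V" for y z by (auto simp: D_def W_def)
  have D_cong: "D y = D z" if "(y, z) \<in> E" for y z
    using equiv_class_eq[OF E that] by (simp add: D_def)
  have N_minus_D: "card (?N z - D z) \<le> s * ?n" if z: "z \<in> ?V" for z
  proof -
    have "card (?N z - D z) * (s * ?n) \<le> (\<Sum>w\<in>?N z - D z. real (card (?N w - E `` {z})))"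
      using nbrs_subset by (intro sum_bounded_below) (auto simp: D_def)
    also have "\<dots> \<le> (\<Sum>w\<in>?N z. real (card (?N w - E `` {z})))"
      by (intro sum_mono2) auto
    also have "\<dots> = (\<Sum>w\<in>?N z. real (card (?N w \<inter> (?V - E `` {z}))))"
      using nbrs_subset by (intro sum.cong refl arg_cong[where f = real] arg_cong[where f = card]) blast
    also have "\<dots> = (\<Sum>y\<in>?V - E `` {z}. real (card (?N y \<inter> ?N z)))"
      using sum_card_nbrs_swap[of "?N z" "?V - E `` {z}"] pair_finite_verts
      by (simp flip: of_nat_sum)
    also have "\<dots> \<le> (\<Sum>y\<in>?V - E `` {z}. s\<^sup>2 * ?n)"
    proof (rule sum_mono)
      fix y assume "y \<in> ?V - E `` {z}"
      then have "codeg G y z \<le> s\<^sup>2 * ?n" using z symE by (intro codeg) auto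
      then show "real (card (?N y \<inter> ?N z)) \<le> s\<^sup>2 * ?n" by (simp add: codeg_def)
    qed
    also have "\<dots> = card (?V - E `` {z}) * (s\<^sup>2 * ?n)" by simp
    also have "\<dots> \<le> ?n * (s\<^sup>2 * ?n)"
      using pair_finite_verts by (intro mult_right_mono of_nat_mono card_mono) auto
    also have "\<dots> = (s * ?n) * (s * ?n)" by (simp add: power2_eq_square)
    finally show ?thesis using s n by simp
  qed
  have card_diff2: "real (card A) \<le> card B + card (A - P) + card (A - Q)"
    if "finite A" "finite B" "A \<inter> P \<inter> Q \<subseteq> B" for A B P Q :: "'a set"
  proof -
    have "card A \<le> card (B \<union> (A - P) \<union> (A - Q))" using that by (intro card_mono) auto
    also have "\<dots> \<le> card B + card (A - P) + card (A - Q)"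
      using card_Un_le[of "B \<union> (A - P)" "A - Q"] card_Un_le[of B "A - P"] by linarith
    finally show ?thesis by linarith
  qed
  have "s * ?n > 0" using s n by simp
  then have small: "s * ?n + s * ?n < d" "s * ?n < d" using large n by linarith+
  have W_opposite: "?n / 4 < card (W z y)" if "w \<in> W y z" "y \<in> ?V" "z \<in> ?V" for w y z
  proof -
    have w: "(y, w) \<in> E" "w \<in> ?V" "card (?N w - E `` {z}) \<le> s * ?n"
      using that by (auto simp: W_def D_def)
    have "D w = D y" using D_cong w symE by blast
    then have "card (?N w - D y) \<le> s * ?n" using N_minus_D[OF w(2)] by simp
    moreover have "real (card (?N w)) \<le> card (W z y) + card (?N w - E `` {z}) + card (?N w - D y)"
      by (rule card_diff2) (auto simp: W_def fin[OF DV])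
    ultimately show ?thesis using deg[OF w(2)] w(3) large by linarith
  qed
  have W_both: "?n / 4 < card (W z y) \<and> ?n / 4 < card (W y z)"
    if "w \<in> W y z" "y \<in> ?V" "z \<in> ?V" for w y z
  proof -
    have "?n / 4 < card (W z y)" using W_opposite that by blast
    moreover from this obtain v where "v \<in> W z y"
      using n by (metis card.empty ex_in_conv divide_nonneg_nonneg leD of_nat_0 of_nat_0_le_iff zero_le_numeral)
    ultimately show ?thesis using W_opposite that by blast
  qed
  have cls_disjoint: "E `` {y} \<inter> E `` {z} = {}" if "(y, z) \<notin> E" for y z
    using that equiv_class_nondisjoint[OF E] by fast
  have D_disjoint: "D y \<inter> D z = {}" if "(y, z) \<notin> E" for y z
  proof (rule ccontr)
    assume "D y \<inter> D z \<noteq> {}"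
    then obtain w where w: "w \<in> D y" "w \<in> D z" by blast
    have "real (card (?N w)) \<le> card ({} :: 'a set) + card (?N w - E `` {y}) + card (?N w - E `` {z})"
      using cls_disjoint[OF that] by (intro card_diff2) auto
    then show False using w small deg[of w] by (simp add: D_def)
  qed
  have D_ex: "\<exists>w. w \<in> W w z \<and> (w, z) \<notin> E \<and> w \<in> ?V" if "z \<in> ?V" for z
  proof -
    have "?N z - D z \<noteq> ?N z" using N_minus_D[OF that] deg[OF that] small by auto
    then obtain w where w: "w \<in> ?N z" "w \<in> D z" by blast
    then have "w \<in> ?V" using DV by blast
    moreover have "(w, z) \<notin> E" using w indep symE by (auto simp: nbrs_def)
    ultimately show ?thesis using w reflE by (auto simp: W_def)
  qed
  obtain w where w: "w \<in> W w x" "(w, x) \<notin> E" "w \<in> ?V" using D_ex[OF x] by blast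
  have "(z, x) \<in> E \<or> (z, w) \<in> E" if z: "z \<in> ?V" for z
  proof (rule ccontr)
    assume neg: "\<not> ?thesis"
    obtain y where y: "y \<in> W y z" "(y, z) \<notin> E" "y \<in> ?V" using D_ex[OF z] by blast
    have sizes: "?n / 4 < card (W x w)" "?n / 4 < card (W w x)"
        "?n / 4 < card (W z y)" "?n / 4 < card (W y z)"
      using W_both[OF w(1,3) x] W_both[OF y(1,3) z] by auto
    have cls: "E `` {z} \<inter> E `` {x} = {}" "E `` {z} \<inter> E `` {w} = {}" "E `` {x} \<inter> E `` {w} = {}"
        "E `` {z} \<inter> E `` {y} = {}"
      using neg w(2) y(2) symE by (auto intro!: cls_disjoint)
    have Ds: "D z \<inter> D x = {}" "D z \<inter> D w = {}"
      using neg by (auto intro!: D_disjoint)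
    have dis: "W x w \<inter> W w x = {}" "W z y \<inter> (W x w \<union> W w x) = {}"
        "W y z \<inter> (W x w \<union> W w x \<union> W z y) = {}"
      using cls Ds unfolding W_def by blast+
    have "card (W x w \<union> W w x \<union> W z y \<union> W y z) = card (W x w) + card (W w x) + card (W z y) + card (W y z)"
      using dis fin[OF WV] by (subst card_Un_disjoint; auto)+
    moreover have "card (W x w \<union> W w x \<union> W z y \<union> W y z) \<le> card ?V"
      using WV pair_finite_verts by (intro card_mono) auto
    ultimately show False using sizes by linarith
  qed
  with w(3) show ?thesis using that by blast
qed

end

section \<open>Graphs with minimum degree above a quarter\<close>

text \<open>
  Here \<open>s = e / 3\<close> satisfies \<open>2 * s < e\<close>, which is what the counting in \<open>at_most_two_classes\<close> needs, and two
  vertices count as related if they have at least \<open>s\<^sup>2 * n\<close> common neighbours.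
\<close>

lemma (in pair_graph) chain_free_2_colourable:
  fixes e :: real
  assumes e: "e > 0"
    and deg: "\<And>v. v \<in> pverts G \<Longrightarrow> (1 / 4 + e) * card (pverts G) \<le> card (nbrs G v)"
    and large: "22 * 8 ^ 4 \<le> (e / 3)\<^sup>2 * card (pverts G)"
    and free: "\<not> embeds c4_chain G"
  obtains f where "proper_colouring G 2 f"
proof -
  let ?V = "pverts G"
  define n where "n = real (card ?V)"
  define s where "s = e / 3"
  define c where "c = s\<^sup>2 * n"
  define d where "d = (1 / 4 + e) * n"
  define E where "E = (codeg_rel c)\<^sup>* \<inter> ?V \<times> ?V"
  have n: "n > 0"
  proof (rule ccontr)
    assume "\<not> n > 0"
    then have "card ?V = 0" by (simp add: n_def)
    then show False using large by simp
  qed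
  then obtain x where x: "x \<in> ?V" by (auto simp: n_def card_gt_0_iff)
  have dn: "d \<le> card (nbrs G v)" if "v \<in> ?V" for v using deg[OF that] by (simp add: d_def n_def)
  have "card (nbrs G x) \<le> card ?V" using nbrs_subset by (intro card_mono pair_finite_verts)
  then have "(1 / 4 + e) * n \<le> 1 * n" using dn[OF x] by (simp add: d_def n_def)
  then have e1: "e \<le> 3 / 4" using n by simp
  have s: "s > 0" "s \<le> 1 / 4" using e e1 by (auto simp: s_def)
  have "s\<^sup>2 \<le> s * (1 / 4)" unfolding power2_eq_square using s by (intro mult_left_mono) auto
  then have s2: "6 * s\<^sup>2 < 4 * e" "s\<^sup>2 \<le> 1 / 4 + e" using s e by (auto simp: s_def)
  have c1: "card ?V + 6 * c < 4 * d"
  proof -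
    have "6 * s\<^sup>2 * n < 4 * e * n" using s2(1) n by (rule mult_strict_right_mono)
    then show ?thesis by (simp add: c_def d_def n_def algebra_simps)
  qed
  have c2: "c \<le> d" unfolding c_def d_def using s2(2) n by (intro mult_right_mono) auto
  have c3: "22 * 8 ^ 4 \<le> c" using large by (simp add: c_def s_def n_def)
  have no_arc: "(u, v) \<notin> E" if "(u, v) \<in> parcs G" for u v
    using no_arc_in_codeg_class[OF dn c1 c2 c3 free] that by (auto simp: E_def)
  have "equiv ?V E" unfolding E_def by (rule equiv_codeg_rel_rtrancl)
  moreover have "codeg G u v \<le> s\<^sup>2 * card ?V" if "u \<in> ?V" "v \<in> ?V" "(u, v) \<notin> E" for u v
  proof -
    have "(u, v) \<notin> codeg_rel c" using that by (auto simp: E_def)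
    then show ?thesis using that by (simp add: codeg_rel_def c_def n_def)
  qed
  moreover have "card ?V / 4 + 2 * s * card ?V < d"
    using e n by (simp add: d_def s_def n_def algebra_simps)
  ultimately obtain w where w: "w \<in> ?V" "\<And>z. z \<in> ?V \<Longrightarrow> (z, x) \<in> E \<or> (z, w) \<in> E"
    using at_most_two_classes[of E s d x] no_arc s(1) dn x by blast
  have tr: "(u, v) \<in> E" if "(u, z) \<in> E" "(v, z) \<in> E" for u v z
    using \<open>equiv ?V E\<close> that by (meson equivE symE transE)
  have "proper_colouring G 2 (\<lambda>z. if (z, x) \<in> E then 0 else 1)"
    unfolding proper_colouring_def
  proof (intro conjI ballI, safe)
    fix u v assume uv: "(u, v) \<in> parcs G"
      and eq: "(if (u, x) \<in> E then 0 else 1) = (if (v, x) \<in> E then 0 else (1 :: nat))"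
    have "u \<in> ?V" "v \<in> ?V" using uv in_arcsD1 in_arcsD2 by auto
    moreover have "(u, x) \<in> E \<longleftrightarrow> (v, x) \<in> E" using eq by (simp split: if_splits)
    ultimately have "(u, x) \<in> E \<and> (v, x) \<in> E \<or> (u, w) \<in> E \<and> (v, w) \<in> E" using w(2) by blast
    then have "(u, v) \<in> E" using tr by blast
    then show False using no_arc uv by blast
  qed auto
  then show ?thesis using that by blast
qed

lemma pair_graph_add_edge:
  assumes "pair_graph G" "u \<in> pverts G" "v \<in> pverts G" "u \<noteq> v"
  shows "pair_graph (add_edge u v G)"
  using assms unfolding pair_graph_iff by (auto simp: add_edge_def sym_def irrefl_def)

text \<open>
  A bipartite maximal \<open>H\<close>-free graph is complete bipartite, as adding an edge between the two sides
  keeps it bipartite and thus cannot create a copy of the non-bipartite graph \<open>H\<close>.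
\<close>

lemma maximal_chain_free_2_colourable:
  assumes G: "pair_graph G" and max: "maximal_free_of c4_chain G" and col: "proper_colouring G 2 f"
    and uv: "u \<in> pverts G" "v \<in> pverts G"
  shows "(u, v) \<in> parcs G \<longleftrightarrow> f u \<noteq> f v"
proof
  show "f u \<noteq> f v" if "(u, v) \<in> parcs G" using col that by (auto simp: proper_colouring_def)
next
  assume neq: "f u \<noteq> f v"
  show "(u, v) \<in> parcs G"
  proof (rule ccontr)
    assume nin: "(u, v) \<notin> parcs G"
    have "u \<noteq> v" using neq by auto
    with nin max uv have "\<not> free_of c4_chain (add_edge u v G)" by (auto simp: maximal_free_of_def)
    then have "embeds c4_chain (add_edge u v G)"
      using free_of_iff_not_embeds pair_graph_chain pair_graph_add_edge[OF G uv \<open>u \<noteq> v\<close>]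
      by (metis pair_graph_def pair_digraph_def pair_fin_digraph_def)
    then obtain h where h: "h ` pverts c4_chain \<subseteq> pverts G"
        "\<And>a b. (a, b) \<in> parcs c4_chain \<Longrightarrow> (h a, h b) \<in> parcs G \<union> {(u, v), (v, u)}"
      unfolding embeds_def add_edge_def by fastforce
    have "proper_colouring c4_chain 2 (f \<circ> h)"
      unfolding proper_colouring_def
    proof (intro conjI ballI, safe)
      fix a assume "a \<in> pverts c4_chain"
      then show "(f \<circ> h) a < 2" using col h(1) by (auto simp: proper_colouring_def)
    next
      fix a b assume "(a, b) \<in> parcs c4_chain" "(f \<circ> h) a = (f \<circ> h) b"
      then show False using h(2)[of a b] col neq by (auto simp: proper_colouring_def)
    qed
    then show False using chain_not_2_colourable by blast
  qed
qed

text \<open>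
  There is a finite graph \<open>F\<close> of which every graph is a blowup whose vertices can be labelled with fewer than
  \<open>N\<close> labels such that the labels determine adjacency. The graph \<open>F\<close> is a disjoint union of copies
  of all graphs on the labels: a vertex is a pair of a relation \<open>g\<close> on the labels and a label, encoded as a
  number by an arbitrary injection \<open>e\<close>. Only pairs related in both directions become edges, so that
  \<open>g\<close> itself need not be symmetric.
\<close>

lemma exists_universal_blowup_pattern:
  fixes N :: nat
  obtains F :: "nat pair_pre_digraph" where "pair_graph F"
    "\<And>(G :: 'a pair_pre_digraph) f g. pair_graph G \<Longrightarrow> (\<And>v. v \<in> pverts G \<Longrightarrow> f v < N) \<Longrightarrow>
      (\<And>u v. u \<in> pverts G \<Longrightarrow> v \<in> pverts G \<Longrightarrow> (u, v) \<in> parcs G \<longleftrightarrow> (f u, f v) \<in> g) \<Longrightarrow>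
      is_blowup F G"
proof -
  define P where "P = Pow ({..<N} \<times> {..<N}) \<times> {..<N}"
  have fP: "finite P" by (simp add: P_def)
  then obtain e :: "(nat \<times> nat) set \<times> nat \<Rightarrow> nat" where e: "inj_on e P"
    using finite_imp_inj_to_nat_seg[OF fP] by blast
  define F where "F = \<lparr>pverts = e ` P, parcs = {(e (g, i), e (g, j)) | g i j.
      (g, i) \<in> P \<and> (g, j) \<in> P \<and> i \<noteq> j \<and> (i, j) \<in> g \<and> (j, i) \<in> g}\<rparr>"
  have "pair_graph F"
    unfolding pair_graph_iff
  proof (intro conjI)
    show "finite (pverts F)" using fP by (simp add: F_def)
    show "parcs F \<subseteq> pverts F \<times> pverts F" by (auto simp: F_def)
    show "sym (parcs F)" unfolding F_def sym_def by fastforce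
    show "irrefl (parcs F)" using e by (auto simp: F_def irrefl_def dest: inj_onD)
  qed
  moreover have "is_blowup F G" if G: "pair_graph G" and f: "\<And>v. v \<in> pverts G \<Longrightarrow> f v < N"
      and g: "\<And>u v. u \<in> pverts G \<Longrightarrow> v \<in> pverts G \<Longrightarrow> (u, v) \<in> parcs G \<longleftrightarrow> (f u, f v) \<in> g"
    for G :: "'a pair_pre_digraph" and f g
  proof -
    interpret pair_graph G by fact
    \<comment> \<open>The relation \<open>g\<close> is arbitrary outside the labels in use, so it is replaced by the image of the arcs.\<close>
    define g' where "g' = {(f u, f v) | u v. (u, v) \<in> parcs G}"
    define B where "B x = {v \<in> pverts G. x = e (g', f v)}" for x
    have P: "(g', f v) \<in> P" if "v \<in> pverts G" for v
      using f that in_arcsD1 in_arcsD2 by (auto simp: P_def g'_def)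
    have arc: "(u, v) \<in> parcs G \<longleftrightarrow> (f u, f v) \<in> g'" if "u \<in> pverts G" "v \<in> pverts G" for u v
    proof
      assume "(f u, f v) \<in> g'"
      then obtain u' v' where "f u = f u'" "f v = f v'" "(u', v') \<in> parcs G" by (auto simp: g'_def)
      then show "(u, v) \<in> parcs G" using g in_arcsD1 in_arcsD2 that by metis
    qed (auto simp: g'_def)
    have "disjoint_family_on B (pverts F)" by (auto simp: disjoint_family_on_def B_def)
    moreover have "pverts G = (\<Union>x\<in>pverts F. B x)" using P by (auto simp: B_def F_def)
    moreover have "parcs G = (\<Union>(x, y)\<in>parcs F. B x \<times> B y)"
    proof (intro equalityI subsetI)
      fix a assume a: "a \<in> parcs G"
      obtain u v where uv: "a = (u, v)" by (cases a)
      have V: "u \<in> pverts G" "v \<in> pverts G" using a uv in_arcsD1 in_arcsD2 by auto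
      have "(f u, f v) \<in> g'" "(f v, f u) \<in> g'"
        using arc[OF V] arc[OF V(2,1)] a uv arcs_symmetric by blast+
      moreover have "f u \<noteq> f v"
      proof
        assume "f u = f v"
        then have "(u, u) \<in> parcs G" using arc V \<open>(f u, f v) \<in> g'\<close> by simp
        then show False using no_loops' by blast
      qed
      ultimately have "(e (g', f u), e (g', f v)) \<in> parcs F" using P V by (auto simp: F_def)
      then show "a \<in> (\<Union>(x, y)\<in>parcs F. B x \<times> B y)" using uv V by (auto simp: B_def)
    next
      fix a assume "a \<in> (\<Union>(x, y)\<in>parcs F. B x \<times> B y)"
      then obtain u v where uv: "a = (u, v)" "u \<in> pverts G" "v \<in> pverts G"
          "(e (g', f u), e (g', f v)) \<in> parcs F"
        by (auto simp: B_def)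
      then obtain h i j where h: "e (g', f u) = e (h, i)" "e (g', f v) = e (h, j)"
          "(h, i) \<in> P" "(h, j) \<in> P" "(i, j) \<in> h"
        by (auto simp: F_def)
      then have "(g', f u) = (h, i)" "(g', f v) = (h, j)" using e P uv by (auto dest: inj_onD)
      then show "a \<in> parcs G" using h(5) arc uv by auto
    qed
    ultimately show ?thesis unfolding is_blowup_def by blast
  qed
  ultimately show ?thesis using that by blast
qed

text \<open>
  Below a constant size every graph is its own pattern, with an injective labelling; above it the two
  colours are the labels. The number of labels is at least 2 to cover the second case.
\<close>

lemma blowup_pattern_above_quarter:
  fixes \<alpha> :: real
  assumes "\<alpha> > 1 / 4"
  obtains F :: "nat pair_pre_digraph" where "pair_graph F"
    "\<And>G :: 'a pair_pre_digraph. pair_graph G \<Longrightarrow> maximal_free_of c4_chain G \<Longrightarrow>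
       \<alpha> * card (pverts G) \<le> min_degree G \<Longrightarrow> is_blowup F G"
proof -
  define e where "e = \<alpha> - 1 / 4"
  have e: "e > 0" "\<alpha> = 1 / 4 + e" using assms by (auto simp: e_def)
  obtain N0 :: nat where N0: "22 * 8 ^ 4 / (e / 3)\<^sup>2 \<le> N0" using real_arch_simple by blast
  define N where "N = N0 + 2"
  obtain F :: "nat pair_pre_digraph" where F: "pair_graph F"
    "\<And>(G :: 'a pair_pre_digraph) f g. pair_graph G \<Longrightarrow> (\<And>v. v \<in> pverts G \<Longrightarrow> f v < N) \<Longrightarrow>
      (\<And>u v. u \<in> pverts G \<Longrightarrow> v \<in> pverts G \<Longrightarrow> (u, v) \<in> parcs G \<longleftrightarrow> (f u, f v) \<in> g) \<Longrightarrow>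
      is_blowup F G"
    using exists_universal_blowup_pattern[of N] by blast
  have "is_blowup F G" if G: "pair_graph G" and max: "maximal_free_of c4_chain G"
    and deg: "\<alpha> * card (pverts G) \<le> min_degree G" for G :: "'a pair_pre_digraph"
  proof (cases "card (pverts G) \<le> N")
    case True
    interpret pair_graph G by fact
    obtain f :: "'a \<Rightarrow> nat" and m where f: "f ` pverts G = {i. i < m}" "inj_on f (pverts G)"
      using finite_imp_inj_to_nat_seg[OF pair_finite_verts] by blast
    have "m = card (pverts G)" using card_image[OF f(2)] f(1) by simp
    moreover have "f v < m" if "v \<in> pverts G" for v using imageI[OF that, of f] unfolding f(1) by simp
    ultimately have "f v < N" if "v \<in> pverts G" for v using that True less_le_trans by blast
    moreover have "(u, v) \<in> parcs G \<longleftrightarrow> (f u, f v) \<in> map_prod f f ` parcs G"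
      if "u \<in> pverts G" "v \<in> pverts G" for u v
    proof -
      have "inj_on (map_prod f f) (pverts G \<times> pverts G)" by (intro map_prod_inj_on f(2))
      moreover have "parcs G \<subseteq> pverts G \<times> pverts G" using G by (simp add: pair_graph_iff)
      ultimately show ?thesis
        using inj_on_image_mem_iff[of "map_prod f f" "pverts G \<times> pverts G" "(u, v)" "parcs G"] that by simp
    qed
    ultimately show ?thesis by (rule F(2)[OF G])
  next
    case False
    interpret pair_graph G by fact
    have ne: "pverts G \<noteq> {}" using False by auto
    have "(1 / 4 + e) * card (pverts G) \<le> card (nbrs G v)" if "v \<in> pverts G" for v
    proof -
      have "min_degree G \<le> card (nbrs G v)"
        using le_min_degree_iff[OF pair_finite_verts ne, of "min_degree G"] that by simp
      then show ?thesis using deg[unfolded e(2)] by linarith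
    qed
    moreover have "22 * 8 ^ 4 \<le> (e / 3)\<^sup>2 * card (pverts G)"
    proof -
      have "22 * 8 ^ 4 / (e / 3)\<^sup>2 \<le> card (pverts G)" using N0 False by (simp add: N_def)
      then show ?thesis using e(1) by (simp add: divide_le_eq mult.commute)
    qed
    moreover have "\<not> embeds c4_chain G"
      using max free_of_iff_not_embeds[of c4_chain G] G pair_graph_chain
      by (simp add: maximal_free_of_def pair_graph_def pair_digraph_def pair_fin_digraph_def)
    ultimately obtain f where f: "proper_colouring G 2 f"
      using chain_free_2_colourable[OF e(1)] by blast
    have f2: "f v < 2" if "v \<in> pverts G" for v using f that by (auto simp: proper_colouring_def)
    have "(u, v) \<in> parcs G \<longleftrightarrow> (f u, f v) \<in> {(0, 1), (1, 0)}" if "u \<in> pverts G" "v \<in> pverts G" for u v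
      using maximal_chain_free_2_colourable[OF G max f that] f2[OF that(1)] f2[OF that(2)] by auto
    moreover have "f v < N" if "v \<in> pverts G" for v using f2[OF that] by (simp add: N_def)
    ultimately show ?thesis by (intro F(2)[OF G])
  qed
  then show ?thesis using that F(1) by blast
qed

section \<open>Graphs with minimum degree a quarter that are not blowups\<close>

lemma is_blowup_card_nbrs:
  assumes "pair_graph F" "is_blowup F G"
  shows "card (nbrs G ` pverts G) \<le> card (pverts F)"
proof -
  obtain B where B: "disjoint_family_on B (pverts F)" "pverts G = (\<Union>x\<in>pverts F. B x)"
      "parcs G = (\<Union>(x, y)\<in>parcs F. B x \<times> B y)"
    using assms(2) unfolding is_blowup_def by blast
  have F: "finite (pverts F)" "parcs F \<subseteq> pverts F \<times> pverts F" using assms(1) by (auto simp: pair_graph_iff)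
  have "nbrs G v = \<Union> (B ` nbrs F x)" if "x \<in> pverts F" "v \<in> B x" for v x
  proof -
    have "y = x" if "y \<in> pverts F" "v \<in> B y" for y
      using B(1) that \<open>x \<in> pverts F\<close> \<open>v \<in> B x\<close> by (auto simp: disjoint_family_on_def)
    then show ?thesis using F(2) that(2) by (fastforce simp: nbrs_def B(3))
  qed
  then have "nbrs G ` pverts G \<subseteq> (\<lambda>x. \<Union> (B ` nbrs F x)) ` pverts F"
    by (auto simp: B(2))
  then show ?thesis using F(1) by (meson card_image_le card_mono finite_imageI le_trans)
qed

lemma exists_maximal_free_supergraph:
  assumes G: "pair_graph G" and free: "free_of H G"
  obtains A where "parcs G \<subseteq> A" "pair_graph \<lparr>pverts = pverts G, parcs = A\<rparr>"
    "maximal_free_of H \<lparr>pverts = pverts G, parcs = A\<rparr>"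
proof -
  let ?g = "\<lambda>A. \<lparr>pverts = pverts G, parcs = A\<rparr>"
  define S where "S = {A. parcs G \<subseteq> A \<and> pair_graph (?g A) \<and> free_of H (?g A)}"
  have "S \<subseteq> Pow (pverts G \<times> pverts G)" by (auto simp: S_def pair_graph_iff)
  moreover have "finite (pverts G)" using G by (simp add: pair_graph_iff)
  ultimately have "finite S" by (meson finite_Pow_iff finite_SigmaI finite_subset)
  moreover have eq: "?g (parcs G) = G" by simp
  have "parcs G \<in> S" unfolding S_def mem_Collect_eq eq using G free by blast
  ultimately obtain A where A: "A \<in> S" "\<And>A'. A' \<in> S \<Longrightarrow> A \<subseteq> A' \<Longrightarrow> A = A'"
    using finite_has_maximal[of S] by blast
  have "\<not> free_of H (add_edge u v (?g A))"
    if "u \<in> pverts G" "v \<in> pverts G" "u \<noteq> v" "(u, v) \<notin> A" for u v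
  proof
    assume "free_of H (add_edge u v (?g A))"
    moreover have "pair_graph (add_edge u v (?g A))"
      using A(1) that by (intro pair_graph_add_edge) (auto simp: S_def)
    ultimately have "A \<union> {(u, v), (v, u)} \<in> S"
      using A(1) by (auto simp: S_def add_edge_def)
    then show False using A(2) that by blast
  qed
  then have "maximal_free_of H (?g A)" using A(1) by (auto simp: maximal_free_of_def S_def)
  then show ?thesis using A(1) that by (auto simp: S_def)
qed

text \<open>
  Adjacency in the following graph: there are four parts, numbered 0 to 3, whose vertices are indexed by
  \<open>i\<close>. Parts 0 and 1 span a complete bipartite graph, and so do parts 2 and 3. In addition, the vertex with
  index \<open>i\<close> of part 0 is joined to the vertices with index \<open>i\<close> of parts 2 and 3. The arguments of
  \<open>part_adj i p j q\<close> are index and part of the first and of the second vertex.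
\<close>

definition part_adj :: "nat \<Rightarrow> nat \<Rightarrow> nat \<Rightarrow> nat \<Rightarrow> bool" where
  "part_adj i p j q \<longleftrightarrow> (p, q) \<in> {(0, 1), (1, 0), (2, 3), (3, 2)} \<or>
     i = j \<and> (p, q) \<in> {(0, 2), (2, 0), (0, 3), (3, 0)}"

lemma part_adj_sym: "part_adj i p j q \<longleftrightarrow> part_adj j q i p"
  by (auto simp: part_adj_def)

lemma part_adj_irrefl: "\<not> part_adj i p j p"
  by (auto simp: part_adj_def)

lemma common_nbr_of_different_parts:
  assumes "part_adj i p k r" "part_adj j q k r" "p \<noteq> q"
  shows "(k, r) = (if p = 0 then (i, if q = 2 then 3 else 2)
    else if q = 0 then (j, if p = 2 then 3 else 2) else (if p = 1 then j else i, 0))"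
  using assms unfolding part_adj_def by auto

text \<open>
  The outer ends of two incident edges of the complete bipartite graphs lie in the same part. So for two
  vertices of different parts, a common neighbour is reached from one of them by a matching edge; it is unique.
\<close>

lemma two_common_nbrs_same_part:
  assumes "part_adj i p k r" "part_adj j q k r" "part_adj i p l t" "part_adj j q l t"
    and "(k, r) \<noteq> (l, t)"
  shows "p = q"
  using common_nbr_of_different_parts[OF assms(1,2)] common_nbr_of_different_parts[OF assms(3,4)]
    assms(5) by metis

text \<open>
  The vertex with index \<open>i\<close> in part \<open>p\<close> is encoded as the number \<open>4 * i + p\<close>.
\<close>

definition linked_bicliques :: "nat \<Rightarrow> nat pair_pre_digraph" where
  "linked_bicliques N = \<lparr>pverts = {..<4 * N}, parcs = {(u, v) \<in> {..<4 * N} \<times> {..<4 * N}.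
     part_adj (u div 4) (u mod 4) (v div 4) (v mod 4)}\<rparr>"

lemma pair_graph_linked_bicliques: "pair_graph (linked_bicliques N)"
  unfolding pair_graph_iff
proof (intro conjI)
  show "sym (parcs (linked_bicliques N))"
    unfolding linked_bicliques_def sym_def using part_adj_sym by auto
qed (auto simp: linked_bicliques_def irrefl_def part_adj_irrefl)

lemma part_arc:
  assumes "i < N" "j < N" "p < 4" "q < 4" "part_adj i p j q"
  shows "(4*i+p, 4*j+q) \<in> parcs (linked_bicliques N)"
  using assms by (auto simp: linked_bicliques_def)

text \<open>
  Consecutive spine vertices of a copy of \<open>H\<close> have two common neighbours, so the whole spine lies in
  one part; but its two ends are adjacent.
\<close>

lemma linked_bicliques_chain_free: "\<not> embeds c4_chain (linked_bicliques N)"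
proof
  let ?G = "linked_bicliques N"
  assume "embeds c4_chain ?G"
  then obtain f :: "nat \<Rightarrow> nat" where inj: "inj_on f {..<16}" and e: "f 15 \<in> nbrs ?G (f 0)"
    and T: "\<forall>i<5. {f (3*i+1), f (3*i+2)} \<subseteq> nbrs ?G (f (3*i)) \<inter> nbrs ?G (f (3*i+3))"
    unfolding embeds_chain_iff[OF pair_graph_linked_bicliques] by (elim exE conjE)
  have adj: "part_adj (u div 4) (u mod 4) (v div 4) (v mod 4)" if "v \<in> nbrs ?G u" for u v
    using that by (auto simp: nbrs_def linked_bicliques_def)
  have step: "f (3*i) mod 4 = f (3*(Suc i)) mod 4" if i: "i < 5" for i
  proof -
    have "f (3*i+1) \<noteq> f (3*i+2)" using inj i by (auto dest: inj_onD)
    then have "(f (3*i+1) div 4, f (3*i+1) mod 4) \<noteq> (f (3*i+2) div 4, f (3*i+2) mod 4)"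
      by (metis div_mult_mod_eq prod.inject)
    moreover have "f (3*i+1) \<in> nbrs ?G (f (3*i))" "f (3*i+1) \<in> nbrs ?G (f (3*i+3))"
        "f (3*i+2) \<in> nbrs ?G (f (3*i))" "f (3*i+2) \<in> nbrs ?G (f (3*i+3))"
      using T i by simp_all
    note this[THEN adj]
    ultimately have "f (3*i) mod 4 = f (3*i+3) mod 4"
      by (intro two_common_nbrs_same_part)
    then show ?thesis by (simp add: algebra_simps)
  qed
  have "f 0 mod 4 = f (3*i) mod 4" if "i \<le> 5" for i
    using that by (induction i) (use step in auto)
  from this[of 5] have "f 0 mod 4 = f 15 mod 4" by simp
  then show False using adj[OF e] part_adj_irrefl by simp
qed

text \<open>
  Let \<open>a\<close> be the vertex with index \<open>i\<close> of part 0. It has a neighbour in part 3, and if it has two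
  neighbours in part 2, with indices \<open>i\<close> and \<open>j\<close>, then it can be the first spine vertex of a copy of \<open>H\<close> that lies otherwise in
  the complete bipartite graph on parts 2 and 3, with the remaining spine in part 3. For this copy
  eight further indices \<open>h 0\<close>, ..., \<open>h 7\<close> are needed.
\<close>

lemma crossing_arc_creates_chain:
  assumes G: "pair_graph G" and V: "pverts G = {..<4 * N}" and sup: "parcs (linked_bicliques N) \<subseteq> parcs G"
    and arc: "(4*i, 4*j+2) \<in> parcs G" and neq: "i \<noteq> j" and ij: "i < N" "j < N" and N: "10 \<le> N"
  shows "embeds c4_chain G"
proof -
  interpret pair_graph G by fact
  have "card ({..<N} - {i, j}) \<ge> 8" using N ij neq by (simp add: card_Diff_subset)
  then obtain K where K: "K \<subseteq> {..<N} - {i, j}" "card K = 8" using obtain_subset_with_card_n by metis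
  define h where "h m = sorted_list_of_set K ! m" for m
  have fK: "finite K" using K(2) card.infinite by fastforce
  have len: "length (sorted_list_of_set K) = 8" using K fK by simp
  have hK: "h m < N" "h m \<noteq> i" "h m \<noteq> j" if "m < 8" for m
    using nth_mem[of m "sorted_list_of_set K"] that len K fK by (auto simp: h_def)
  have hinj: "h a = h b \<longleftrightarrow> a = b" if "a < 8" "b < 8" for a b
    using that len nth_eq_iff_index_eq[of "sorted_list_of_set K" a b] by (simp add: h_def)
  \<comment> \<open>The images of the vertices 0 to 15 of \<open>H\<close>, as pairs of index and part.\<close>
  define ps where "ps = [(i, 0), (i, 2), (j, 2), (h 0, 3), (h 0, 2), (h 1, 2), (h 1, 3), (h 2, 2),
     (h 3, 2), (h 2, 3), (h 4, 2), (h 5, 2), (h 3, 3), (h 6, 2), (h 7, 2), (i, 3 :: nat)]"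
  define g where "g = (\<lambda>(k, p). 4 * k + p :: nat)"
  define f where "f m = g (ps ! m)" for m
  have hN: "h 0 < N" "h 1 < N" "h 2 < N" "h 3 < N" "h 4 < N" "h 5 < N" "h 6 < N" "h 7 < N"
    by (rule hK; simp)+
  have set_ps: "k < N \<and> p < 4" if "(k, p) \<in> set ps" for k p
    using that ij hN by (auto simp: ps_def)
  have len_ps: "length ps = 16" by (simp add: ps_def)
  have "distinct ps"
    using neq by (simp add: ps_def hinj hK hK(2,3)[symmetric])
  have "inj_on g (set ps)"
  proof (rule inj_onI, clarify)
    fix k p l q assume "(k, p) \<in> set ps" "(l, q) \<in> set ps" "g (k, p) = g (l, q)"
    moreover from this have "p < 4" "q < 4" using set_ps by auto
    ultimately show "k = l \<and> p = q" unfolding g_def split_conv by presburger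
  qed
  then have "inj_on f {..<16}"
    using \<open>distinct ps\<close> len_ps unfolding inj_on_def f_def
    by (metis lessThan_iff nth_eq_iff_index_eq nth_mem)
  moreover have "f ` {..<16} \<subseteq> pverts G"
  proof (rule image_subsetI)
    fix m :: nat assume "m \<in> {..<16}"
    then have "ps ! m \<in> set ps" using len_ps by simp
    then show "f m \<in> pverts G" using set_ps[of "fst (ps ! m)" "snd (ps ! m)"]
      by (auto simp: f_def g_def V split: prod.splits)
  qed
  moreover have nbr: "g (l, q) \<in> nbrs G (g (k, p))" "g (k, p) \<in> nbrs G (g (l, q))"
    if "part_adj k p l q" "k < N" "l < N" "p < 4" "q < 4" for k p l q
    using part_arc[of k N l p q] that sup nbrs_sym by (auto simp: g_def nbrs_def dest: arcs_symmetric)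
  have cross: "g (j, 2) \<in> nbrs G (g (i, 0))" using arc by (simp add: g_def nbrs_def)
  have "f 15 \<in> nbrs G (f 0)"
    using ij by (simp add: f_def ps_def nbr part_adj_def)
  moreover have "\<forall>m<5. {f (3*m+1), f (3*m+2)} \<subseteq> nbrs G (f (3*m)) \<inter> nbrs G (f (3*m+3))"
    using ij hN cross by (simp add: All_less_Suc eval_nat_numeral f_def ps_def nbr part_adj_def)
  ultimately show ?thesis unfolding embeds_chain_iff[OF G] by blast
qed

text \<open>
  In any maximal \<open>H\<close>-free graph that contains the linked bicliques, the only neighbour in part 2 of the
  vertex with index \<open>i\<close> of part 0 is the one with index \<open>i\<close>. Hence the vertices of part 0 have pairwise
  different neighbourhoods, whereas a blowup of \<open>F\<close> has at most as many neighbourhoods as \<open>F\<close> has vertices.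
\<close>

lemma exists_chain_free_non_blowup:
  fixes F :: "nat pair_pre_digraph"
  assumes F: "pair_graph F"
  obtains G :: "nat pair_pre_digraph" where "pair_graph G" "maximal_free_of c4_chain G"
    "card (pverts G) \<le> 4 * min_degree G" "\<not> is_blowup F G"
proof -
  \<comment> \<open>More indices than \<open>F\<close> has vertices, and at least the ten required by \<open>crossing_arc_creates_chain\<close>.\<close>
  define N where "N = card (pverts F) + 10"
  let ?L = "linked_bicliques N"
  have wf: "pair_wf_digraph G" if "pair_graph G" for G :: "nat pair_pre_digraph"
    using that by (simp add: pair_graph_def pair_digraph_def pair_fin_digraph_def)
  have "free_of c4_chain ?L"
    using free_of_iff_not_embeds[OF wf[OF pair_graph_chain] wf[OF pair_graph_linked_bicliques]]
      linked_bicliques_chain_free by blast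
  then obtain A where A: "parcs ?L \<subseteq> A" "pair_graph \<lparr>pverts = pverts ?L, parcs = A\<rparr>"
      "maximal_free_of c4_chain \<lparr>pverts = pverts ?L, parcs = A\<rparr>"
    using exists_maximal_free_supergraph[OF pair_graph_linked_bicliques] by blast
  define G where "G = \<lparr>pverts = pverts ?L, parcs = A\<rparr>"
  have V: "pverts G = {..<4 * N}" and arcs: "parcs ?L \<subseteq> parcs G"
    using A(1) by (auto simp: G_def linked_bicliques_def)
  have G: "pair_graph G" "maximal_free_of c4_chain G" using A by (auto simp: G_def)
  interpret pair_graph G by fact
  have free: "\<not> embeds c4_chain G"
    using G(2) free_of_iff_not_embeds[OF wf[OF pair_graph_chain] wf[OF G(1)]]
    by (simp add: maximal_free_of_def)
  have "N \<le> card (nbrs G v)" if "v \<in> pverts G" for v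
  proof -
    \<comment> \<open>The part that is completely joined to the part of \<open>v\<close>.\<close>
    define q where "q = (if v mod 4 = 0 then 1 else if v mod 4 = 1 then 0 else if v mod 4 = 2 then 3 else (2 :: nat))"
    have "v mod 4 < 4" by simp
    then have "v mod 4 = 0 \<or> v mod 4 = 1 \<or> v mod 4 = 2 \<or> v mod 4 = 3" by presburger
    then have q: "part_adj (v div 4) (v mod 4) k q" "q < 4" for k by (auto simp: q_def part_adj_def)
    have "(\<lambda>k. 4 * k + q) ` {..<N} \<subseteq> nbrs G v"
    proof (rule image_subsetI)
      fix k assume "k \<in> {..<N}"
      moreover have "v div 4 < N" using that V by auto
      ultimately have "(4 * (v div 4) + v mod 4, 4 * k + q) \<in> parcs ?L"
        using q by (intro part_arc) auto
      then show "4 * k + q \<in> nbrs G v" using arcs by (auto simp: nbrs_def)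
    qed
    from card_mono[OF _ this] show ?thesis by (simp add: card_image inj_on_def)
  qed
  moreover have "0 \<in> pverts G" by (simp add: V N_def)
  ultimately have "N \<le> min_degree G"
    using le_min_degree_iff[OF pair_finite_verts, of N] by blast
  then have "card (pverts G) \<le> 4 * min_degree G" by (simp add: V)
  moreover have "\<not> is_blowup F G"
  proof
    assume "is_blowup F G"
    then have le: "card (nbrs G ` pverts G) \<le> card (pverts F)" by (rule is_blowup_card_nbrs[OF F])
    have "inj_on (\<lambda>i. nbrs G (4 * i)) {..<N}"
    proof (rule inj_onI, rule ccontr)
      fix i j assume ij: "i \<in> {..<N}" "j \<in> {..<N}" "nbrs G (4 * i) = nbrs G (4 * j)" "i \<noteq> j"
      have "(4 * j + 0, 4 * j + 2) \<in> parcs ?L" using ij by (intro part_arc) (auto simp: part_adj_def)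
      then have "(4 * i, 4 * j + 2) \<in> parcs G" using arcs ij(3) by (auto simp: nbrs_def)
      then have "embeds c4_chain G"
        using ij by (intro crossing_arc_creates_chain[OF G(1) V arcs, of i j]) (auto simp: N_def)
      then show False using free by simp
    qed
    then have "N = card ((\<lambda>i. nbrs G (4 * i)) ` {..<N})" by (simp add: card_image)
    also have "\<dots> \<le> card (nbrs G ` pverts G)"
      by (intro card_mono) (auto simp: V)
    finally show False using le by (simp add: N_def)
  qed
  ultimately show ?thesis using that G by blast
qed

section \<open>The blowup threshold\<close>

theorem theorem1p3:
  shows "\<exists>H :: nat pair_pre_digraph.
           pair_graph H \<and> chromatic_number H = 3 \<and> blowup_threshold H = 1 / 4"
proof (intro exI conjI)
  show "pair_graph c4_chain" by (rule pair_graph_chain)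
  show "chromatic_number c4_chain = 3" by (rule chromatic_number_chain)
  show "blowup_threshold c4_chain = 1 / 4"
    unfolding blowup_threshold_def
  proof (rule cInf_eq, goal_cases)
    case (1 \<alpha>)
    then obtain F :: "nat pair_pre_digraph" where F: "pair_graph F"
      "\<And>G :: nat pair_pre_digraph. pair_graph G \<Longrightarrow> maximal_free_of c4_chain G \<Longrightarrow>
         \<alpha> * card (pverts G) \<le> min_degree G \<Longrightarrow> is_blowup F G"
      by blast
    obtain G :: "nat pair_pre_digraph" where G: "pair_graph G" "maximal_free_of c4_chain G"
        "card (pverts G) \<le> 4 * min_degree G" "\<not> is_blowup F G"
      using exists_chain_free_non_blowup[OF F(1)] by blast
    show ?case
    proof (rule ccontr)
      assume "\<not> 1 / 4 \<le> \<alpha>"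
      then have "\<alpha> * card (pverts G) \<le> 1 / 4 * card (pverts G)" by (intro mult_right_mono) auto
      also have "\<dots> \<le> min_degree G" using G(3) by linarith
      finally show False using F(2) G by blast
    qed
  next
    case (2 y)
    show ?case
    proof (rule field_le_epsilon)
      fix e :: real assume "e > 0"
      then obtain F :: "nat pair_pre_digraph" where "pair_graph F"
        "\<And>G :: nat pair_pre_digraph. pair_graph G \<Longrightarrow> maximal_free_of c4_chain G \<Longrightarrow>
           (1 / 4 + e) * card (pverts G) \<le> min_degree G \<Longrightarrow> is_blowup F G"
        using blowup_pattern_above_quarter[of "1 / 4 + e"] by auto
      then show "y \<le> 1 / 4 + e" using \<open>e > 0\<close> by (intro 2) auto
    qed
  qed
qed

end
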